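(* Let $I$ be an open interval in $\mathbb{R}$. If $f \in S^1(I)$ and $f^{\mathrm{sd}}$ is bounded on $I$, then $f$ is Lipschitz continuous on $I$, $f'$ exists $\mathcal{L}^1$-a.e. on $I$, and $f' = f^{\mathrm{sd}}$ $\mathcal{L}^1$-a.e. on $I$.
   Context: For an open interval $I\subset\mathbb{R}$, a function $f:I\to\mathbb{R}$ and a point $x\in I$, the specular derivative of $f$ at $x$ is $$f^{\mathrm{sd}}(x) := \lim_{h \searrow 0} \mathcal{A}(f(x + h) - f(x), f(x) - f(x - h), h)$$ (with $h>0$ small enough that $x\pm h\in I$), where $\mathcal{A}:\mathbb{R}\times\mathbb{R}\times(0,\infty)\to\mathbb{R}$ is $$\mathcal{A}(a, b, c) := \frac{a \sqrt{b^2 + c^2} + b \sqrt{a^2 + c^2}}{c \sqrt{a^2 + c^2} + c \sqrt{b^2 + c^2}}.$$ $f$ is specularly differentiable at $x$ if this limit exists as a finite real number, and specularly differentiable on $I$ if it is so at every point of $I$. $S^0(I)$ is the set of functions $f:I\to\mathbb{R}$ that are specularly differentiable on $I$, and $S^1(I):=C^0(I)\cap S^0(I)$, where $C^0(I)$ is the set of continuous real-valued functions on $I$. $\mathcal{L}^1$ is Lebesgue measure on $\mathbb{R}$; $f'$ is the classical derivative. *)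

theory Defs
  imports "HOL-Analysis.Analysis"
begin

text \<open>
  A function on an open interval \<open>I\<close> is represented by a total function \<open>real \<Rightarrow> real\<close>
  of which only the values on \<open>I\<close> matter: all limits below are taken at points of the
  open set \<open>I\<close> and so depend only on the values of the function near that point.
\<close>

(* Meaningful for c > 0 only; below, c is the increment h > 0 along "at_right 0". *)
definition specular_A :: "real \<Rightarrow> real \<Rightarrow> real \<Rightarrow> real" where
  "specular_A a b c =
     (a * sqrt (b\<^sup>2 + c\<^sup>2) + b * sqrt (a\<^sup>2 + c\<^sup>2)) /
     (c * sqrt (a\<^sup>2 + c\<^sup>2) + c * sqrt (b\<^sup>2 + c\<^sup>2))"

definition has_specular_derivative :: "(real \<Rightarrow> real) \<Rightarrow> real \<Rightarrow> real \<Rightarrow> bool" where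
  "has_specular_derivative f D x \<longleftrightarrow>
     ((\<lambda>h. specular_A (f (x + h) - f x) (f x - f (x - h)) h) \<longlongrightarrow> D) (at_right 0)"

definition specularly_differentiable_at :: "(real \<Rightarrow> real) \<Rightarrow> real \<Rightarrow> bool" where
  "specularly_differentiable_at f x \<longleftrightarrow> (\<exists>D. has_specular_derivative f D x)"

(* An unspecified value where the limit does not exist. *)
definition specular_deriv :: "(real \<Rightarrow> real) \<Rightarrow> real \<Rightarrow> real" where
  "specular_deriv f x =
     Lim (at_right 0) (\<lambda>h. specular_A (f (x + h) - f x) (f x - f (x - h)) h)"

definition S0 :: "real set \<Rightarrow> (real \<Rightarrow> real) set" where
  "S0 I = {f. \<forall>x\<in>I. specularly_differentiable_at f x}"

definition S1 :: "real set \<Rightarrow> (real \<Rightarrow> real) set" where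
  "S1 I = {f. continuous_on I f} \<inter> S0 I"

end

theory Submission
  imports Defs
begin

text \<open>
  Dividing by \<^term>\<open>c\<close> turns \<^term>\<open>specular_A a b c\<close> into a weighted mean of the
  right slope \<open>\<alpha> = a / c\<close> and the left slope \<open>\<beta> = b / c\<close>, with weights proportional to
  \<open>sqrt (1 + \<beta>\<^sup>2)\<close> and \<open>sqrt (1 + \<alpha>\<^sup>2)\<close>.  Two properties of this mean carry the proof: it is at
  least the smaller of the two slopes, and it is a continuous function of the slopes that maps
  equal slopes to their common value.

  The first property gives a mean value inequality.  If the chord of a continuous \<open>f\<close> over
  \<open>[a, b]\<close> is steeper than \<open>m\<close>, then \<open>f x - m * x\<close> crosses some level upwards, and at the point
  where it first leaves the region below that level the left slopes of \<open>f\<close> are all at least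
  \<open>m\<close> and arbitrarily short right slopes are at least \<open>m\<close>; so the specular derivative there is at
  least \<open>m\<close> (\<open>specular_mean_value_ge\<close>).  Applied to \<open>f\<close> and \<open>- f\<close>, this makes
  any bound of the absolute value of the specular derivative a Lipschitz constant.

  The second property shows that the specular derivative agrees with the classical one wherever
  the latter exists, so what is left is that a Lipschitz function of one real variable is
  differentiable almost everywhere.  Adding a steep linear function makes it a
  bi-Lipschitz increasing bijection \<open>g\<close>; the measure \<open>A \<mapsto> \<lambda>(g(A))\<close> is then
  absolutely continuous with respect to Lebesgue measure \<open>\<lambda>\<close> because Lipschitz maps preserve
  null sets, and its Radon-Nikodym density \<open>\<phi>\<close> satisfies \<open>g y - g x = \<integral>\<^sub>x\<^sup>y \<phi>\<close>
  (\<open>bilipschitz_increasing_is_integral\<close>).  Lebesgue's differentiation theorem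
  (\<open>derivative_of_integral_AE\<close>) finishes the argument.
\<close>

section \<open>The specular quotient as a mean of the one-sided slopes\<close>

text \<open>
  A mean of the slopes \<open>a / c\<close> and \<open>b / c\<close> with positive weights is at least the smaller one.
\<close>

lemma specular_A_ge:
  assumes "0 < c" "m * c \<le> a" "m * c \<le> b"
  shows "m \<le> specular_A a b c"
proof -
  define s t where "s = sqrt (b\<^sup>2 + c\<^sup>2)" and "t = sqrt (a\<^sup>2 + c\<^sup>2)"
  have st: "0 < s" "0 < t"
    using assms(1) by (simp_all add: s_def t_def add_nonneg_pos)
  have "m * (c * t + c * s) = (m * c) * s + (m * c) * t"
    by (simp add: algebra_simps)
  also have "\<dots> \<le> a * s + b * t"
    using assms st by (intro add_mono mult_right_mono) auto
  finally have "m * (c * t + c * s) \<le> a * s + b * t" .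
  moreover have "0 < c * t + c * s"
    using assms(1) st by (intro add_pos_pos) auto
  ultimately show ?thesis
    by (simp add: specular_A_def s_def t_def pos_le_divide_eq)
qed

lemma specular_A_uminus: "specular_A (- a) (- b) c = - specular_A a b c"
proof -
  have "- a * s + - b * t = - (a * s + b * t)" for s t
    by (simp add: algebra_simps)
  then show ?thesis
    by (simp only: specular_A_def power2_minus minus_divide_left)
qed

text \<open>
  Homogeneity reduces the specular quotient to a function of the two slopes alone.  Unlike the
  original expression, that function is continuous with no degeneration as \<^term>\<open>c\<close> tends to
  \<open>0\<close>.
\<close>

lemma specular_A_slopes:
  assumes "0 < c"
  shows "specular_A a b c = specular_A (a / c) (b / c) 1"
proof -
  have s: "sqrt (x\<^sup>2 + c\<^sup>2) = c * sqrt ((x / c)\<^sup>2 + 1)" for x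
  proof -
    have "x\<^sup>2 + c\<^sup>2 = c\<^sup>2 * ((x / c)\<^sup>2 + 1)"
      using assms by (simp add: field_simps)
    then show ?thesis
      using assms by (metis abs_of_pos real_sqrt_abs real_sqrt_mult)
  qed
  define p q where "p = sqrt ((b / c)\<^sup>2 + 1)" and "q = sqrt ((a / c)\<^sup>2 + 1)"
  have "0 < p" "0 < q"
    by (simp_all add: p_def q_def add_nonneg_pos)
  then have "q + p \<noteq> 0" by linarith
  have "specular_A a b c = (a * (c * p) + b * (c * q)) / (c * (c * q) + c * (c * p))"
    by (simp only: specular_A_def s p_def q_def)
  also have "\<dots> = (c * (a * p + b * q)) / (c * (c * (q + p)))"
    by (simp add: algebra_simps)
  also have "\<dots> = (a * p + b * q) / (c * (q + p))"
    using assms by simp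
  also have "\<dots> = (a / c * p + b / c * q) / (1 * q + 1 * p)"
    using assms \<open>q + p \<noteq> 0\<close> by (simp add: field_simps)
  also have "\<dots> = specular_A (a / c) (b / c) 1"
    by (simp add: specular_A_def p_def q_def)
  finally show ?thesis .
qed

lemma has_specular_derivative_unique:
  assumes "has_specular_derivative f D x"
  shows "specular_deriv f x = D"
  using assms unfolding has_specular_derivative_def specular_deriv_def
  by (intro tendsto_Lim) auto

lemma has_specular_derivative_uminus:
  assumes "has_specular_derivative f D x"
  shows "has_specular_derivative (\<lambda>x. - f x) (- D) x"
proof -
  have "specular_A (- f (x + h) - - f x) (- f x - - f (x - h)) h
      = - specular_A (f (x + h) - f x) (f x - f (x - h)) h" for h
    using specular_A_uminus[of "f (x + h) - f x" "f x - f (x - h)" h] by simp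
  then show ?thesis
    using tendsto_minus[OF assms[unfolded has_specular_derivative_def]]
    by (simp add: has_specular_derivative_def)
qed

text \<open>
  Both slopes tend to the classical derivative, so by continuity in the slopes the specular
  quotient tends to the mean of two equal numbers.
\<close>

lemma has_specular_derivative_real_derivative:
  assumes "(f has_real_derivative D) (at x)"
  shows "has_specular_derivative f D x"
proof -
  have q: "((\<lambda>h. (f (x + h) - f x) / h) \<longlongrightarrow> D) (at 0)"
    using assms by (simp add: DERIV_def)
  then have 1: "((\<lambda>h. (f (x + h) - f x) / h) \<longlongrightarrow> D) (at_right 0)"
    by (rule filterlim_mono) (auto simp: at_le)
  have "((\<lambda>h. (f (x + h) - f x) / h) \<longlongrightarrow> D) (at_left 0)"
    using q by (rule filterlim_mono) (auto simp: at_le)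
  then have "((\<lambda>h. (f (x + - h) - f x) / - h) \<longlongrightarrow> D) (at_right 0)"
    by (simp add: filterlim_at_left_to_right)
  then have 2: "((\<lambda>h. (f x - f (x - h)) / h) \<longlongrightarrow> D) (at_right 0)"
    by (rule Lim_transform_eventually) (auto simp: minus_divide_left)
  have nz: "sqrt (D\<^sup>2 + 1) + sqrt (D\<^sup>2 + 1) \<noteq> 0"
  proof -
    have "0 < sqrt (D\<^sup>2 + 1)" by (simp add: add_nonneg_pos)
    then show ?thesis by linarith
  qed
  have "((\<lambda>h. specular_A ((f (x + h) - f x) / h) ((f x - f (x - h)) / h) 1)
      \<longlongrightarrow> specular_A D D 1) (at_right 0)"
    unfolding specular_A_def using nz by (intro tendsto_intros 1 2) auto
  moreover have "specular_A D D 1 = D"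
    using nz by (simp add: specular_A_def field_simps)
  ultimately have "((\<lambda>h. specular_A ((f (x + h) - f x) / h) ((f x - f (x - h)) / h) 1)
      \<longlongrightarrow> D) (at_right 0)" by simp
  then show ?thesis
    unfolding has_specular_derivative_def
  proof (rule Lim_transform_eventually)
    show "\<forall>\<^sub>F h in at_right 0. specular_A ((f (x + h) - f x) / h) ((f x - f (x - h)) / h) 1
        = specular_A (f (x + h) - f x) (f x - f (x - h)) h"
      using eventually_at_right_less[of 0] by eventually_elim (rule specular_A_slopes[symmetric])
  qed
qed

section \<open>A mean value inequality and the Lipschitz bound\<close>

text \<open>
  A one-sided substitute for the mean value theorem.  The exceptional point \<^term>\<open>c\<close> is found
  as the first exit of \<open>g x = f x - m * x\<close> from a sublevel set \<open>{x. g x \<le> k}\<close> with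
  \<open>g a < k < g b\<close>.  To the left of \<^term>\<open>c\<close> the values do not exceed
  \<open>g c = k\<close>, and points above the level accumulate at \<^term>\<open>c\<close> from the right.  Such a point
  \<open>c + h\<close> and its mirror image \<open>c - h\<close> make both slopes at least \<^term>\<open>m\<close>, hence the specular
  quotient too; a sequence of such \<open>h\<close> suffices, since the limit is assumed to exist.
\<close>

lemma specular_mean_value_ge:
  fixes f :: "real \<Rightarrow> real"
  assumes "a < b" "continuous_on {a..b} f" and m: "m * (b - a) < f b - f a"
  obtains c where "a < c" "c < b" "\<And>D. has_specular_derivative f D c \<Longrightarrow> m \<le> D"
proof -
  define g where "g = (\<lambda>x. f x - m * x)"
  have cont: "continuous_on {a..b} g"
    unfolding g_def by (intro continuous_intros assms)
  have "g a < g b" using m by (simp add: g_def algebra_simps)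
  then obtain k where k: "g a < k" "k < g b" using dense by blast
  define S where "S = {x\<in>{a..b}. k < g x}"
  define c where "c = Inf S"
  have bS: "b \<in> S" using k assms by (auto simp: S_def)
  have bdd: "bdd_below S" by (auto simp: S_def intro!: bdd_belowI[of _ a])
  have "c \<in> closure S"
    unfolding c_def using bS bdd by (intro closure_contains_Inf) auto
  moreover have "closed {x\<in>{a..b}. k \<le> g x}"
    using cont by (intro continuous_on_closed_Collect_le) auto
  then have "closure S \<subseteq> {x\<in>{a..b}. k \<le> g x}"
    by (intro closure_minimal) (auto simp: S_def)
  ultimately have c: "a \<le> c" "c \<le> b" "k \<le> g c" by auto
  have "c \<noteq> a" using c k by auto
  then have "a < c" using c by simp
  have left: "g x \<le> k" if "a \<le> x" "x < c" for x
  proof (rule ccontr)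
    assume "\<not> g x \<le> k"
    then have "x \<in> S" using that c by (auto simp: S_def)
    then show False using cInf_lower[OF _ bdd] that by (force simp: c_def)
  qed
  have "closed {x\<in>{a..b}. g x \<le> k}"
    using cont by (intro continuous_on_closed_Collect_le) auto
  then have "closure {a..<c} \<subseteq> {x\<in>{a..b}. g x \<le> k}"
    using c left by (intro closure_minimal) auto
  then have "g c \<le> k" using \<open>a < c\<close> by (auto simp: subset_iff)
  then have gc: "g c = k" using c by simp
  then have "c \<noteq> b" using k by auto
  then have "c < b" using c by simp
  show ?thesis
  proof (rule that)
    fix D assume D: "has_specular_derivative f D c"
    show "m \<le> D"
    proof (rule ccontr)
      assume "\<not> m \<le> D"
      then have "\<forall>\<^sub>F h in at_right 0. specular_A (f (c + h) - f c) (f c - f (c - h)) h < m"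
        using D order_tendstoD(2) by (force simp: has_specular_derivative_def)
      then obtain d where d: "0 < d"
        "\<And>h. 0 < h \<Longrightarrow> h < d \<Longrightarrow> specular_A (f (c + h) - f c) (f c - f (c - h)) h < m"
        by (auto simp: eventually_at_right_field)
      obtain x where x: "x \<in> S" "x < c + min d (c - a)"
        using cInf_less_iff[of S "c + min d (c - a)"] bS bdd d(1) \<open>a < c\<close>
        by (auto simp: c_def[symmetric])
      define h where "h = x - c"
      have "c \<le> x" using cInf_lower[OF x(1) bdd] by (simp add: c_def)
      moreover have "x \<noteq> c" using x gc by (auto simp: S_def)
      ultimately have h: "0 < h" "h < d" "h < c - a" using x by (auto simp: h_def)
      have "g c \<le> g (c + h)" "g (c - h) \<le> g c"
        using x gc left[of "c - h"] h by (auto simp: h_def S_def)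
      then have "m \<le> specular_A (f (c + h) - f c) (f c - f (c - h)) h"
        using h by (intro specular_A_ge) (auto simp: g_def algebra_simps)
      then show False using d(2)[of h] h by simp
    qed
  qed fact+
qed

lemma specular_derivative_bound_imp_le:
  fixes f :: "real \<Rightarrow> real"
  assumes "x \<le> y" "continuous_on {x..y} f"
    and "\<And>z. z \<in> {x<..<y} \<Longrightarrow> \<exists>D. has_specular_derivative f D z \<and> D \<le> M"
  shows "f y - f x \<le> M * (y - x)"
proof (rule ccontr)
  assume "\<not> ?thesis"
  then have lt: "M * (y - x) < f y - f x" and "x < y"
    using assms(1) by (auto simp: not_le less_le)
  then have "M < (f y - f x) / (y - x)" by (simp add: pos_less_divide_eq)
  then obtain m where "M < m" "m < (f y - f x) / (y - x)" using dense by blast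
  then have "m * (y - x) < f y - f x" using \<open>x < y\<close> by (simp add: pos_less_divide_eq)
  then obtain c where "x < c" "c < y" "\<And>D. has_specular_derivative f D c \<Longrightarrow> m \<le> D"
    using specular_mean_value_ge \<open>x < y\<close> assms(2) by blast
  then show False using assms(3)[of c] \<open>M < m\<close> by fastforce
qed

lemma lipschitz_on_specular_derivative_bound:
  fixes f :: "real \<Rightarrow> real"
  assumes "is_interval I" "continuous_on I f" "0 \<le> M"
    and D: "\<And>z. z \<in> I \<Longrightarrow> \<exists>D. has_specular_derivative f D z \<and> \<bar>D\<bar> \<le> M"
  shows "M-lipschitz_on I f"
proof (rule lipschitz_onI)
  have le: "\<bar>f y - f x\<bar> \<le> M * (y - x)" if "x \<in> I" "y \<in> I" "x \<le> y" for x y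
  proof -
    have sub: "{x..y} \<subseteq> I"
      using mem_is_interval_1_I[OF assms(1) that(1,2)] by auto
    have cont: "continuous_on {x..y} f" using assms(2) sub continuous_on_subset by blast
    have "f y - f x \<le> M * (y - x)"
    proof (rule specular_derivative_bound_imp_le[OF that(3) cont])
      fix z assume "z \<in> {x<..<y}"
      then have "z \<in> I" using sub by auto
      then show "\<exists>D. has_specular_derivative f D z \<and> D \<le> M" using D by fastforce
    qed
    moreover have "- f y - - f x \<le> M * (y - x)"
    proof (rule specular_derivative_bound_imp_le[OF that(3), where f = "\<lambda>x. - f x"])
      show "continuous_on {x..y} (\<lambda>x. - f x)" using cont by (intro continuous_intros)
      fix z assume "z \<in> {x<..<y}"
      then have "z \<in> I" using sub by auto
      then obtain D where "has_specular_derivative f D z" "\<bar>D\<bar> \<le> M" using D by blast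
      then show "\<exists>D. has_specular_derivative (\<lambda>x. - f x) D z \<and> D \<le> M"
        using has_specular_derivative_uminus by (intro exI[of _ "- D"]) auto
    qed
    ultimately show ?thesis by linarith
  qed
  show "dist (f x) (f y) \<le> M * dist x y" if "x \<in> I" "y \<in> I" for x y
    using le[of x y] le[of y x] that by (cases "x \<le> y") (auto simp: dist_real_def abs_minus_commute)
qed fact

section \<open>Lipschitz functions of one real variable are differentiable almost everywhere\<close>

text \<open>
  The Lebesgue differentiation theorem for the cubes with a given lower left corner, read in
  dimension one.  It controls right difference quotients only.
\<close>

lemma right_derivative_of_integral:
  fixes F \<phi> :: "real \<Rightarrow> real"
  assumes "\<And>x y. x \<le> y \<Longrightarrow> (\<phi> has_integral (F y - F x)) {x..y}"
  obtains N where "negligible N"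
    "\<And>x. x \<notin> N \<Longrightarrow> ((\<lambda>h. (F (x + h) - F x) / h) \<longlongrightarrow> \<phi> x) (at_right 0)"
proof -
  have "\<phi> integrable_on cbox a b" for a b
    using assms[of a b] by (cases "a \<le> b") (auto simp: integrable_on_def)
  then obtain N where N: "negligible N"
    "\<And>x e. \<lbrakk>x \<notin> N; 0 < e\<rbrakk> \<Longrightarrow> \<exists>d>0. \<forall>h. 0 < h \<and> h < d \<longrightarrow>
        norm (integral (cbox x (x + h *\<^sub>R One)) \<phi> /\<^sub>R h ^ DIM(real) - \<phi> x) < e"
    using integrable_ccontinuous_explicit by blast
  show ?thesis
  proof (rule that[OF N(1)])
    fix x assume x: "x \<notin> N"
    show "((\<lambda>h. (F (x + h) - F x) / h) \<longlongrightarrow> \<phi> x) (at_right 0)"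
    proof (rule tendstoI)
      fix e :: real assume "0 < e"
      then obtain d where d: "d > 0" "\<And>h. 0 < h \<Longrightarrow> h < d \<Longrightarrow>
          norm (integral (cbox x (x + h *\<^sub>R One)) \<phi> /\<^sub>R h ^ DIM(real) - \<phi> x) < e"
        using N(2)[OF x] by blast
      have "dist ((F (x + h) - F x) / h) (\<phi> x) < e" if "0 < h" "h < d" for h
      proof -
        have "integral {x..x + h} \<phi> = F (x + h) - F x"
          using assms[of x "x + h"] that by (simp add: integral_unique)
        then show ?thesis
          using d(2)[OF that] by (simp add: dist_real_def divide_inverse mult.commute)
      qed
      then show "\<forall>\<^sub>F h in at_right 0. dist ((F (x + h) - F x) / h) (\<phi> x) < e"
        using d(1) by (auto simp: eventually_at_right_field)
    qed
  qed
qed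

text \<open>
  Reflecting the line turns left difference quotients into right ones, so the one-sided result
  applies twice; both one-sided derivatives are given by the same density.
\<close>

lemma derivative_of_integral_AE:
  fixes F \<phi> :: "real \<Rightarrow> real"
  assumes int: "\<And>x y. x \<le> y \<Longrightarrow> (\<phi> has_integral (F y - F x)) {x..y}"
  obtains N where "negligible N" "\<And>x. x \<notin> N \<Longrightarrow> (F has_real_derivative \<phi> x) (at x)"
proof -
  obtain N1 where N1: "negligible N1"
    "\<And>x. x \<notin> N1 \<Longrightarrow> ((\<lambda>h. (F (x + h) - F x) / h) \<longlongrightarrow> \<phi> x) (at_right 0)"
    using right_derivative_of_integral[of \<phi> F] int by blast
  have "((\<lambda>x. \<phi> (- x)) has_integral (- F (- y) - - F (- x))) {x..y}" if "x \<le> y" for x y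
    using has_integral_reflect_lemma_real[OF int[of "- y" "- x"]] that by simp
  then obtain N2 where N2: "negligible N2"
    "\<And>x. x \<notin> N2 \<Longrightarrow>
      ((\<lambda>h. (- F (- (x + h)) - - F (- x)) / h) \<longlongrightarrow> \<phi> (- x)) (at_right 0)"
    using right_derivative_of_integral[of "\<lambda>x. \<phi> (- x)" "\<lambda>x. - F (- x)"] by blast
  show ?thesis
  proof (rule that)
    have "negligible (uminus ` N2)"
    proof (rule negligible_locally_Lipschitz_image[OF _ N2(1)])
      show "\<exists>T B. open T \<and> x \<in> T \<and> (\<forall>y \<in> N2 \<inter> T. norm (- y - - x) \<le> B * norm (y - x))"
        for x :: real
        by (intro exI[of _ UNIV] exI[of _ "1::real"]) auto
    qed simp
    then show "negligible (N1 \<union> uminus ` N2)" using N1(1) by simp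
    fix x assume x: "x \<notin> N1 \<union> uminus ` N2"
    then have "- x \<notin> N2" by (metis UnCI image_eqI minus_minus)
    then have "((\<lambda>h. (- F (x - h) + F x) / h) \<longlongrightarrow> \<phi> x) (at_right 0)"
      using N2(2)[of "- x"] by (simp add: algebra_simps)
    then have "((\<lambda>h. (F (x + - h) - F x) / - h) \<longlongrightarrow> \<phi> x) (at_right 0)"
      by (rule Lim_transform_eventually) (auto simp: divide_simps)
    then have "((\<lambda>h. (F (x + h) - F x) / h) \<longlongrightarrow> \<phi> x) (at_left 0)"
      by (simp add: filterlim_at_left_to_right)
    then show "(F has_real_derivative \<phi> x) (at x)"
      using N1(2)[of x] x by (simp add: DERIV_def filterlim_split_at)
  qed
qed

text \<open>
  The density \<^term>\<open>\<phi>\<close> is the Radon-Nikodym derivative of \<open>\<mu> A = \<lambda>(g(A))\<close>, where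
  \<open>\<lambda>\<close> is Lebesgue measure, since \<open>\<mu> [x, y]\<close> is the length of \<open>[g x, g y]\<close>.
  Being continuous and growing at least like the identity, \<^term>\<open>g\<close> is a bijection, so that \<open>\<mu>\<close> is the image
  of \<open>\<lambda>\<close> under the inverse; the Lipschitz bound makes \<open>\<mu>\<close> absolutely continuous.
\<close>

lemma bilipschitz_increasing_is_integral:
  fixes g :: "real \<Rightarrow> real"
  assumes lip: "C-lipschitz_on UNIV g"
    and incr: "\<And>x y. x \<le> y \<Longrightarrow> y - x \<le> g y - g x"
  obtains \<phi> :: "real \<Rightarrow> real" where "\<And>x y. x \<le> y \<Longrightarrow> (\<phi> has_integral (g y - g x)) {x..y}"
proof -
  have cont: "continuous_on UNIV g"
    using lip by (rule lipschitz_on_continuous_on)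
  have le_iff: "g x \<le> g y \<longleftrightarrow> x \<le> y" for x y
    using incr[of x y] incr[of y x] by linarith
  have "inj g" by (metis injI le_iff order_antisym order_refl)
  have "\<exists>x. g x = v" for v
  proof -
    define r where "r = \<bar>v - g 0\<bar>"
    \<comment> \<open>The growth bound gives \<open>g (- r) \<le> g 0 - r\<close> and \<open>g 0 + r \<le> g r\<close>, which enclose \<open>v\<close>.\<close>
    have "g (- r) \<le> v" "v \<le> g r" "- r \<le> r"
      using incr[of "- r" 0] incr[of 0 r] by (auto simp: r_def)
    then show ?thesis
      using IVT'[of g "- r" v r] continuous_on_subset[OF cont] by blast
  qed
  then have "surj g" by (metis surjI)
  define k where "k = inv g"
  have gk: "g (k v) = v" and kg: "k (g x) = x" for v x
    using \<open>surj g\<close> \<open>inj g\<close> by (auto simp: k_def surj_f_inv_f)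
  have "mono k" using le_iff gk by (intro monoI) metis
  then have k_meas: "k \<in> borel_measurable borel" by (rule borel_measurable_mono)
  have vim: "k -` A = g ` A" for A :: "real set"
  proof (intro set_eqI iffI)
    fix v assume "v \<in> k -` A"
    then show "v \<in> g ` A" by (intro image_eqI[of _ _ "k v"]) (auto simp: gk)
  qed (auto simp: kg)
  define \<mu> where "\<mu> = distr lborel borel k"
  have sets: "sets \<mu> = sets lborel" by (simp add: \<mu>_def)
  have em: "emeasure \<mu> A = emeasure lborel (g ` A)" if "A \<in> sets borel" for A
    using that k_meas by (simp add: \<mu>_def emeasure_distr vim)
  have "absolutely_continuous lborel \<mu>"
    unfolding absolutely_continuous_def
  proof
    fix A :: "real set" assume A: "A \<in> null_sets lborel"
    then have Ab: "A \<in> sets borel" by auto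
    have "negligible A"
      using A by (simp add: negligible_iff_null_sets null_sets_completionI)
    then have "negligible (g ` A)"
    proof (rule negligible_locally_Lipschitz_image[rotated])
      fix x
      show "\<exists>T B. open T \<and> x \<in> T \<and> (\<forall>y \<in> A \<inter> T. norm (g y - g x) \<le> B * norm (y - x))"
        using lipschitz_onD[OF lip] by (intro exI[of _ UNIV] exI[of _ C]) (auto simp: dist_norm)
    qed simp
    moreover have "g ` A \<in> sets borel"
      using measurable_sets[OF k_meas Ab] by (simp add: vim)
    ultimately have "emeasure lborel (g ` A) = 0"
      by (simp add: negligible_iff_null_sets null_sets_def)
    then show "A \<in> null_sets \<mu>"
      using Ab em[OF Ab] sets by (auto simp: null_sets_def)
  qed
  then obtain \<psi> where \<psi>: "\<psi> \<in> borel_measurable lborel" "density lborel \<psi> = \<mu>"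
    using sigma_finite_measure.Radon_Nikodym[OF lborel.sigma_finite_measure_axioms] sets by blast
  have nn: "(\<integral>\<^sup>+t. \<psi> t * indicator {x..y} t \<partial>lborel) = ennreal (g y - g x)" if "x \<le> y" for x y
  proof -
    have "g ` {x..y} = {g x..g y}"
    proof (intro set_eqI iffI)
      fix v assume "v \<in> {g x..g y}"
      then show "v \<in> g ` {x..y}"
        using le_iff[of x "k v"] le_iff[of "k v" y] by (intro image_eqI[of _ _ "k v"]) (auto simp: gk)
    qed (auto simp: le_iff)
    then have "emeasure \<mu> {x..y} = ennreal (g y - g x)"
      using that le_iff by (simp add: em)
    then show ?thesis
      using emeasure_density[OF \<psi>(1), of "{x..y}"] \<psi>(2) by simp
  qed
  show ?thesis
  proof (rule that[of "\<lambda>t. enn2real (\<psi> t)"])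
    fix x y :: real assume xy: "x \<le> y"
    \<comment> \<open>The density may take the value \<open>\<infinity>\<close>, which \<open>enn2real\<close> sends to \<open>0\<close>; this happens only on a
      null set, because the integral over the bounded interval is finite.\<close>
    have "AE t in lborel. \<psi> t * indicator {x..y} t \<noteq> \<infinity>"
      using \<psi>(1) nn[OF xy] by (intro nn_integral_noteq_infinite) auto
    then have "(\<integral>\<^sup>+t. ennreal (enn2real (\<psi> t) * indicator {x..y} t) \<partial>lborel)
        = (\<integral>\<^sup>+t. \<psi> t * indicator {x..y} t \<partial>lborel)"
      by (intro nn_integral_cong_AE) (auto simp: indicator_def less_top split: if_splits)
    then have eq: "(\<integral>\<^sup>+t. ennreal (enn2real (\<psi> t) * indicator {x..y} t) \<partial>lborel)
        = ennreal (g y - g x)"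
      using nn[OF xy] by simp
    have "((\<lambda>t. enn2real (\<psi> t) * indicator {x..y} t) has_integral (g y - g x)) UNIV"
    proof (rule nn_integral_has_integral[OF _ _ eq])
      show "(\<lambda>t. enn2real (\<psi> t) * indicator {x..y} t) \<in> borel_measurable borel"
        using \<psi>(1) by (auto simp: measurable_lborel1)
    qed (use xy le_iff in auto)
    moreover have "(\<lambda>t. enn2real (\<psi> t) * indicator {x..y} t)
        = (\<lambda>t. if t \<in> {x..y} then enn2real (\<psi> t) else 0)"
      by (auto simp: indicator_def)
    ultimately show "((\<lambda>t. enn2real (\<psi> t)) has_integral (g y - g x)) {x..y}"
      by (simp only: has_integral_restrict_UNIV)
  qed
qed

lemma lipschitz_UNIV_differentiable_AE:
  fixes F :: "real \<Rightarrow> real"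
  assumes "L-lipschitz_on UNIV F"
  obtains N where "negligible N" "\<And>x. x \<notin> N \<Longrightarrow> F differentiable (at x)"
proof -
  \<comment> \<open>Slope \<open>L + 1\<close> outweighs the steepest descent of \<open>F\<close> by \<open>1\<close>, the growth rate wanted of \<open>g\<close>.\<close>
  define g where "g = (\<lambda>x. F x + (L + 1) * x)"
  have "0 \<le> L" using assms lipschitz_on_nonneg by blast
  have L: "\<bar>F y - F x\<bar> \<le> L * \<bar>y - x\<bar>" for x y
    using lipschitz_onD[OF assms, of y x] by (simp add: dist_real_def)
  have "y - x \<le> g y - g x" if "x \<le> y" for x y
    using L[of y x] that by (simp add: g_def algebra_simps abs_le_iff)
  moreover have "(L + (L + 1) * 1)-lipschitz_on UNIV g"
    unfolding g_def using \<open>0 \<le> L\<close>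
    by (intro lipschitz_on_add assms lipschitz_on_cmult_real[THEN lipschitz_on_mono]
        lipschitz_on_id) (auto intro: lipschitz_intros)
  ultimately obtain \<phi> where
    "\<And>x y. x \<le> y \<Longrightarrow> (\<phi> has_integral (g y - g x)) {x..y}"
    using bilipschitz_increasing_is_integral by blast
  then obtain N where N: "negligible N" "\<And>x. x \<notin> N \<Longrightarrow> (g has_real_derivative \<phi> x) (at x)"
    using derivative_of_integral_AE by blast
  show ?thesis
  proof (rule that[OF N(1)])
    fix x assume "x \<notin> N"
    then have "((\<lambda>x. g x - (L + 1) * x) has_real_derivative (\<phi> x - (L + 1))) (at x)"
      using N(2) by (auto intro!: derivative_eq_intros)
    then show "F differentiable (at x)"
      by (auto simp: g_def real_differentiable_def)
  qed
qed

text \<open>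
  Differentiability at points of an open set is local, so it suffices to extend the function to
  the whole line: first by uniform continuity to the closed interval, then by composing with
  the nearest-point projection, which does not increase distances.
\<close>

lemma lipschitz_on_interval_differentiable_AE:
  fixes f :: "real \<Rightarrow> real"
  assumes "open I" "is_interval I" "L-lipschitz_on I f"
  obtains N where "negligible N" "\<And>x. x \<in> I - N \<Longrightarrow> f differentiable (at x)"
proof (cases "I = {}")
  case True
  then show ?thesis using that[of "{}"] by simp
next
  case False
  obtain e where e: "L-lipschitz_on (closure I) e" "\<And>x. x \<in> I \<Longrightarrow> e x = f x"
    using lipschitz_extend_closure[OF assms(3)] by blast
  define p where "p = closest_point (closure I)"
  have conv: "convex (closure I)" using assms(2) by (simp add: is_interval_convex)
  have p_in: "p x \<in> closure I" for x
    using False by (simp add: p_def closest_point_in_set)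
  have "1-lipschitz_on UNIV p"
    using conv False closest_point_lipschitz[of "closure I"]
    by (intro lipschitz_onI) (auto simp: p_def)
  moreover have "L-lipschitz_on (p ` UNIV) e"
    using e(1) p_in lipschitz_on_subset by blast
  ultimately have "(L * 1)-lipschitz_on UNIV (\<lambda>x. e (p x))"
    by (rule lipschitz_on_compose2)
  then obtain N where N: "negligible N" "\<And>x. x \<notin> N \<Longrightarrow> (\<lambda>x. e (p x)) differentiable (at x)"
    using lipschitz_UNIV_differentiable_AE by (metis mult.right_neutral)
  show ?thesis
  proof (rule that[OF N(1)])
    fix x assume x: "x \<in> I - N"
    have "e (p y) = f y" if "y \<in> I" for y
      using that e(2) closure_subset[of I] by (simp add: p_def closest_point_self subset_iff)
    then show "f differentiable (at x)"
      using N(2)[of x] x assms(1) unfolding differentiable_def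
      by (metis DiffE has_derivative_transform_within_open)
  qed
qed

section \<open>Functions with a bounded specular derivative\<close>

theorem proposition5p7:
  fixes I :: "real set" and f :: "real \<Rightarrow> real"
  assumes "open I" and "is_interval I"
    and "f \<in> S1 I"
    and "bounded (specular_deriv f ` I)"
  shows "(\<exists>L. L-lipschitz_on I f) \<and>
         (AE x\<in>I in lebesgue. f field_differentiable (at x)) \<and>
         (AE x\<in>I in lebesgue. deriv f x = specular_deriv f x)"
proof -
  have cont: "continuous_on I f" and sd: "\<And>x. x \<in> I \<Longrightarrow> specularly_differentiable_at f x"
    using assms(3) by (auto simp: S1_def S0_def)
  obtain M where M: "0 < M" "\<And>x. x \<in> I \<Longrightarrow> \<bar>specular_deriv f x\<bar> \<le> M"
    using assms(4) by (auto simp: bounded_pos)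
  have lip: "M-lipschitz_on I f"
  proof (rule lipschitz_on_specular_derivative_bound[OF assms(2) cont])
    show "\<exists>D. has_specular_derivative f D z \<and> \<bar>D\<bar> \<le> M" if "z \<in> I" for z
      using sd[OF that] M(2)[OF that] has_specular_derivative_unique
      by (metis specularly_differentiable_at_def)
  qed (use M in simp)
  obtain N where N: "negligible N" "\<And>x. x \<in> I - N \<Longrightarrow> f differentiable (at x)"
    using lipschitz_on_interval_differentiable_AE[OF assms(1,2) lip] by blast
  have null: "N \<in> null_sets lebesgue" using N(1) by (simp add: negligible_iff_null_sets)
  have D: "f field_differentiable (at x) \<and> deriv f x = specular_deriv f x" if x: "x \<in> I - N" for x
  proof -
    obtain D where D: "(f has_real_derivative D) (at x)"
      using N(2)[OF x] real_differentiable_def by blast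
    then have "specular_deriv f x = D"
      by (intro has_specular_derivative_unique has_specular_derivative_real_derivative)
    then show ?thesis
      using D DERIV_imp_deriv by (auto simp: field_differentiable_def)
  qed
  have "AE x\<in>I in lebesgue. f field_differentiable (at x)"
    using D by (intro AE_I'[OF null]) auto
  moreover have "AE x\<in>I in lebesgue. deriv f x = specular_deriv f x"
    using D by (intro AE_I'[OF null]) auto
  ultimately show ?thesis using lip by blast
qed

end
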